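(* Let $Q\subset\mathbb{R}^2$ be the unit disk centered at the origin and, for $k>0$, let $(\mathcal{K}_Q^k)^*$ be the Neumann-Poincaré operator of $Q$ for the Helmholtz operator $\Delta+k^2$. For each integer $n\ge 0$ let $\kappa_{n,k}\in\mathbb{C}$ be the eigenvalue defined by $$(\mathcal{K}_Q^k)^*[e^{in\theta}]=\kappa_{n,k}\,e^{in\theta}.$$ Then $$\lim_{k\to 0}\kappa_{n,k}=\begin{cases}\dfrac12, & n=0,\\[2mm] 0, & n\ge 1,\end{cases}$$ and for every fixed $k>0$, for $n$ sufficiently large (i.e. as $n\to\infty$), $$\kappa_{n,k}=-\frac{k^2}{4n(n-1)(n+1)}+\mathcal{O}\Big(\frac{k^4}{n^4}\Big).$$
   Context: For $k>0$ put $G_k(\mathbf{x})=-\dfrac{i}{4}H_0^{(1)}(k|\mathbf{x}|)$, $\mathbf{x}\in\mathbb{R}^2\setminus\{0\}$, the fundamental solution of $\Delta+k^2$ in $\mathbb{R}^2$, where $H_0^{(1)}$ is the Hankel function of the first kind of order zero. The Neumann-Poincaré operator $(\mathcal{K}_Q^k)^*:H^{-1/2}(\partial Q)\to H^{-1/2}(\partial Q)$ is $$(\mathcal{K}_Q^k)^*[\phi](\mathbf{x})=\mathrm{p.v.}\int_{\partial Q}\frac{\partial G_k(\mathbf{x}-\mathbf{y})}{\partial\nu_{\mathbf{x}}}\,\phi(\mathbf{y})\,ds_{\mathbf{y}},\qquad \mathbf{x}\in\partial Q,$$ where $\nu$ is the exterior unit normal to $\partial Q$, the normal derivative is taken in $\mathbf{x}$,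 and p.v. denotes the Cauchy principal value. The function $e^{in\theta}$ on $\partial Q$ takes the value $e^{in\theta}$ at $(\cos\theta,\sin\theta)$; it is an eigenfunction of $(\mathcal{K}_Q^k)^*$. The $\mathcal{O}$-term is understood for fixed $k$ as $n\to\infty$. *)

theory Defs
  imports "HOL-Analysis.Analysis" "HOL-Library.Landau_Symbols"
begin

text \<open>The plane $\mathbb{R}^2$ is the type \<^typ>\<open>complex\<close>, used as a two-dimensional Euclidean space.\<close>

definition bessel_J0 :: "real \<Rightarrow> real" where
  "bessel_J0 r = (\<Sum>m. (-1) ^ m * (r\<^sup>2 / 4) ^ m / (fact m)\<^sup>2)"

text \<open>The standard expansion of the Bessel function of the second kind of order zero, for \<open>r > 0\<close>;
  \<^term>\<open>harm m\<close> is the \<open>m\<close>-th harmonic number, so the term \<open>m = 0\<close> of the series vanishes.\<close>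

definition bessel_Y0 :: "real \<Rightarrow> real" where
  "bessel_Y0 r = 2 / pi * (ln (r / 2) + euler_mascheroni) * bessel_J0 r
     - 2 / pi * (\<Sum>m. (-1) ^ m * harm m * (r\<^sup>2 / 4) ^ m / (fact m)\<^sup>2)"

definition hankel1_0 :: "real \<Rightarrow> complex" where
  "hankel1_0 r = Complex (bessel_J0 r) (bessel_Y0 r)"

definition helmholtz_G :: "real \<Rightarrow> complex \<Rightarrow> complex" where
  "helmholtz_G k x = - (\<i> / 4) * hankel1_0 (k * norm x)"

text \<open>Arc-length measure on the unit circle: the image of Lebesgue measure on $[0,2\pi)$ under the
  arc-length parametrisation $\theta \mapsto (\cos\theta, \sin\theta)$.\<close>

definition circle_arclength :: "complex measure" where
  "circle_arclength = distr (restrict_space lborel {0..<2 * pi}) borel cis"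

text \<open>Exterior unit normal to the boundary of the unit disk at the boundary point \<open>x\<close>.\<close>

definition disk_normal :: "complex \<Rightarrow> complex" where
  "disk_normal x = x"

text \<open>\<open>\<partial>G\<^sub>k(x - y)/\<partial>\<nu>\<^sub>x\<close>: the derivative in \<open>x\<close>, with \<open>y\<close> held fixed, in the direction
  \<open>\<nu>\<^sub>x\<close>.\<close>

definition normal_deriv_G :: "real \<Rightarrow> complex \<Rightarrow> complex \<Rightarrow> complex" where
  "normal_deriv_G k x y =
     vector_derivative (\<lambda>t. helmholtz_G k (x + t *\<^sub>R disk_normal x - y)) (at 0)"

text \<open>The Neumann-Poincare operator of the unit disk, acting on functions on the unit circle.
  The principal value removes from the circle the points at distance at most \<open>\<epsilon>\<close> from \<open>x\<close>
  and lets \<open>\<epsilon>\<close> decrease to \<open>0\<close>.\<close>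

definition neumann_poincare :: "real \<Rightarrow> (complex \<Rightarrow> complex) \<Rightarrow> complex \<Rightarrow> complex" where
  "neumann_poincare k \<phi> x =
     Lim (at_right 0) (\<lambda>\<epsilon>. LINT y:{y. \<epsilon> < dist x y}|circle_arclength. normal_deriv_G k x y * \<phi> y)"

text \<open>The function $e^{in\theta}$ on the unit circle, as a function of the boundary point.\<close>

definition circle_exp :: "nat \<Rightarrow> complex \<Rightarrow> complex" where
  "circle_exp n x = exp (\<i> * of_nat n * of_real (Arg x))"

lemma circle_exp_cis: "circle_exp n (cis \<theta>) = exp (\<i> * of_nat n * of_real \<theta>)"
proof -
  have "circle_exp n (cis \<theta>) = cis (Arg (cis \<theta>)) ^ n"
    by (simp add: circle_exp_def cis_conv_exp exp_of_nat_mult [symmetric] mult_ac)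
  also have "cis (Arg (cis \<theta>)) = cis \<theta>"
    by (simp add: cis_Arg)
  also have "cis \<theta> ^ n = exp (\<i> * of_nat n * of_real \<theta>)"
    by (simp add: cis_conv_exp exp_of_nat_mult [symmetric] mult_ac)
  finally show ?thesis .
qed

definition np_eigenvalue :: "nat \<Rightarrow> real \<Rightarrow> complex" where
  "np_eigenvalue n k =
     (THE \<kappa>. \<forall>x\<in>sphere 0 1. neumann_poincare k (circle_exp n) x = \<kappa> * circle_exp n x)"

end

theory Submission
  imports Defs "HOL-Real_Asymp.Real_Asymp"
begin

text \<open>On the unit circle \<open>(x - y) \<bullet> x = |x - y|\<^sup>2 / 2\<close>, so the kernel of the Neumann-Poincare operator is a
  bounded function of \<open>u = arg y - arg x\<close>, the principal value is an ordinary integral, and the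
  eigenvalue is the \<open>n\<close>-th cosine coefficient of that function. The series of the Bessel functions expand
  it into the functions \<open>sin^(2m) (u/2)\<close> and \<open>sin^(2m) (u/2) * ln (sin\<^sup>2 (u/2))\<close>. For \<open>m < n\<close> the former are
  orthogonal to \<open>cos (n u)\<close> and the latter have an explicit coefficient of size \<open>n^(-2m-1)\<close>. The term \<open>m = 0\<close> is
  the limit for \<open>k\<close> tending to \<open>0\<close>, the term \<open>m = 1\<close> is the leading asymptotics, and
  the terms \<open>m \<ge> 2\<close> are \<open>O(n^(-4))\<close> with summable constants.\<close>

subsection \<open>Trigonometric moments\<close>

lemma has_integral_cos_nat:
  "((\<lambda>u. cos (real n * u)) has_integral (if n = 0 then 2 * pi else 0)) {0..2 * pi}"
proof (cases "n = 0")
  case True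
  then show ?thesis using has_integral_const_real[of "1::real" 0 "2 * pi"] by simp
next
  case False
  have "((\<lambda>u. cos (real n * u)) has_integral
      (sin (real n * (2 * pi)) / real n - sin (real n * 0) / real n)) {0..2 * pi}"
    using False by (intro fundamental_theorem_of_calculus)
      (auto intro!: derivative_eq_intros simp: has_real_derivative_iff_has_vector_derivative [symmetric])
  moreover have "sin (real n * (2 * pi)) = 0"
    using sin_2npi[of n] by (simp add: mult_ac)
  ultimately show ?thesis using False by simp
qed

text \<open>Through \<open>ln 0 = 0\<close> the product takes at 0 the value 0, which is also its
  limit there. Every logarithm at a zero of \<open>sin (u / 2)\<close> is tamed by this
  function.\<close>

lemma isCont_mult_ln_square: "isCont (\<lambda>v::real. v * ln (v\<^sup>2)) x"
proof (cases "x = 0")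
  case True
  have l: "((\<lambda>v::real. v * ln (v\<^sup>2)) \<longlongrightarrow> 0) (at_left 0)"
    and r: "((\<lambda>v::real. v * ln (v\<^sup>2)) \<longlongrightarrow> 0) (at_right 0)"
    by real_asymp+
  show ?thesis
    unfolding isCont_def True using filterlim_split_at[OF l r] by simp
next
  case False
  then show ?thesis by (intro continuous_intros) auto
qed

text \<open>Telescoping of \<open>sin (j u)\<close>. The extracted factor \<open>sin (u / 2)\<close>
  compensates the logarithmic singularity at the ends of the period.\<close>

lemma sin_nat_mult_eq_sum:
  "sin (real n * u) = sin (u / 2) * (\<Sum>j<n. 2 * cos ((real j + 1 / 2) * u))"
proof (induction n)
  case (Suc n)
  have "sin (real (Suc n) * u) - sin (real n * u) = 2 * sin (u / 2) * cos ((real n + 1 / 2) * u)"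
    by (subst sin_diff_sin) (simp add: algebra_simps add_divide_distrib)
  then show ?case using Suc by (simp add: algebra_simps)
qed simp

lemma sum_cos_half_mult_cos_half:
  "(\<Sum>j<n. 2 * cos ((real j + 1 / 2) * u)) * cos (u / 2)
     = (\<Sum>j<n. cos (real (Suc j) * u) + cos (real j * u))"
  unfolding sum_distrib_right
proof (rule sum.cong)
  fix j
  show "2 * cos ((real j + 1 / 2) * u) * cos (u / 2) = cos (real (Suc j) * u) + cos (real j * u)"
    by (subst cos_plus_cos) (simp add: algebra_simps add_divide_distrib)
qed simp

text \<open>Integration by parts: \<open>G\<close> vanishes at both ends, and differentiating its
  logarithm gives \<open>sin (n u) * cot (u / 2) / n\<close>. By the two preceding identities this
  is the trigonometric polynomial \<open>D u / n\<close>, so only the mean of \<open>D\<close>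
  remains.\<close>

lemma has_integral_ln_sin_cos:
  assumes "n > 0"
  shows "((\<lambda>u. ln ((sin (u / 2))\<^sup>2) * cos (real n * u)) has_integral (- 2 * pi / real n)) {0..2 * pi}"
proof -
  define D where "D = (\<lambda>u. \<Sum>j<n. cos (real (Suc j) * u) + cos (real j * u))"
  define G where "G = (\<lambda>u. sin (real n * u) / real n * ln ((sin (u / 2))\<^sup>2))"
  have "continuous_on {0..2 * pi} G"
  proof -
    \<comment> \<open>In this form \<open>G\<close> is visibly continuous up to the endpoints, where
      the logarithm itself is unbounded nearby.\<close>
    have eq: "G = (\<lambda>u. (\<Sum>j<n. 2 * cos ((real j + 1 / 2) * u)) / real n *
        (\<lambda>v. v * ln (v\<^sup>2)) (sin (u / 2)))"
      unfolding G_def sin_nat_mult_eq_sum by (simp add: mult_ac)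
    have "continuous_on UNIV (\<lambda>v::real. v * ln (v\<^sup>2))"
      using isCont_mult_ln_square by (auto simp: continuous_on_eq_continuous_at)
    then have "continuous_on {0..2 * pi} (\<lambda>u. (\<lambda>v. v * ln (v\<^sup>2)) (sin (u / 2)))"
      by (rule continuous_on_compose2) (auto intro!: continuous_intros)
    moreover have "continuous_on {0..2 * pi} (\<lambda>u. (\<Sum>j<n. 2 * cos ((real j + 1 / 2) * u)) / real n)"
      using assms by (intro continuous_intros) auto
    ultimately show ?thesis
      unfolding eq by (rule continuous_on_mult[rotated])
  qed
  moreover have "(G has_vector_derivative (ln ((sin (u / 2))\<^sup>2) * cos (real n * u) + D u / real n)) (at u)"
    if u: "u \<in> {0<..<2 * pi}" for u
  proof -
    have s: "sin (u / 2) > 0" using u by (intro sin_gt_zero) auto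
    have "(G has_real_derivative (ln ((sin (u / 2))\<^sup>2) * cos (real n * u) +
        sin (real n * u) / real n * (cos (u / 2) / sin (u / 2)))) (at u)"
      unfolding G_def using s assms
      by (auto intro!: derivative_eq_intros simp: field_simps power2_eq_square)
    moreover have "sin (real n * u) / real n * (cos (u / 2) / sin (u / 2)) = D u / real n"
      unfolding D_def sum_cos_half_mult_cos_half [symmetric] sin_nat_mult_eq_sum
      using s by simp
    ultimately show ?thesis
      by (simp only: has_real_derivative_iff_has_vector_derivative)
  qed
  ultimately have "((\<lambda>u. ln ((sin (u / 2))\<^sup>2) * cos (real n * u) + D u / real n)
      has_integral (G (2 * pi) - G 0)) {0..2 * pi}"
    by (intro fundamental_theorem_of_calculus_interior) auto
  moreover have "G (2 * pi) - G 0 = 0"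
    by (simp add: G_def)
  moreover have "((\<lambda>u. D u / real n) has_integral
      (\<Sum>j<n. (if Suc j = 0 then 2 * pi else 0) + (if j = 0 then 2 * pi else 0)) / real n) {0..2 * pi}"
    unfolding D_def
    by (intro has_integral_divide has_integral_sum has_integral_add has_integral_cos_nat) auto
  \<comment> \<open>The only constant among the summands of \<open>D\<close> is the second cosine at
    \<open>j = 0\<close>.\<close>
  moreover have "(\<Sum>j<n. (if Suc j = 0 then 2 * pi else 0) + (if j = 0 then 2 * pi else 0)) = 2 * pi"
    using assms by (simp add: sum.delta')
  ultimately have "((\<lambda>u. ln ((sin (u / 2))\<^sup>2) * cos (real n * u) + D u / real n - D u / real n)
      has_integral (0 - 2 * pi / real n)) {0..2 * pi}"
    by (intro has_integral_diff) auto
  then show ?thesis by simp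
qed

text \<open>Multiplying by \<open>sin\<^sup>2 (u/2) = (1 - cos u)/2\<close> couples only neighbouring frequencies.\<close>

lemma has_integral_sin_square_step:
  fixes f :: "real \<Rightarrow> real"
  assumes "\<And>j. j \<in> {n, n + 1, n + 2} \<Longrightarrow> ((\<lambda>u. f u * cos (real j * u)) has_integral I j) A"
  shows "((\<lambda>u. (sin (u / 2))\<^sup>2 * f u * cos (real (n + 1) * u)) has_integral
      (I (n + 1) / 2 - (I (n + 2) + I n) / 4)) A"
proof -
  have "((\<lambda>u. f u * cos (real (n + 1) * u) / 2 -
      (f u * cos (real (n + 2) * u) + f u * cos (real n * u)) / 4) has_integral
      (I (n + 1) / 2 - (I (n + 2) + I n) / 4)) A"
    by (intro has_integral_diff has_integral_divide has_integral_add assms) auto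
  moreover have "f u * cos (real (n + 1) * u) / 2 -
      (f u * cos (real (n + 2) * u) + f u * cos (real n * u)) / 4
      = (sin (u / 2))\<^sup>2 * f u * cos (real (n + 1) * u)" for u
  proof -
    have s: "(sin (u / 2))\<^sup>2 = (1 - cos u) / 2"
      using cos_double_sin[of "u / 2"] by simp
    have "cos (real (n + 2) * u) + cos (real n * u) = 2 * cos (real (n + 1) * u) * cos u"
      by (subst cos_plus_cos) (simp add: algebra_simps add_divide_distrib)
    then have "f u * cos (real (n + 2) * u) + f u * cos (real n * u)
        = f u * (2 * cos (real (n + 1) * u) * cos u)"
      by (metis distrib_left)
    then show ?thesis
      unfolding s by (simp add: algebra_simps)
  qed
  ultimately show ?thesis by simp
qed

text \<open>\<open>sin^(2m) (u/2)\<close> is a trigonometric polynomial of degree \<open>m\<close>.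
  In the induction the three frequencies \<open>l\<close>, \<open>l + 1\<close>,
  \<open>l + 2\<close> all stay above \<open>m\<close>.\<close>

lemma has_integral_sin_power_cos_zero:
  assumes "m < n"
  shows "((\<lambda>u. (sin (u / 2))\<^sup>2 ^ m * cos (real n * u)) has_integral 0) {0..2 * pi}"
  using assms
proof (induction m arbitrary: n)
  case 0
  then show ?case using has_integral_cos_nat[of n] by simp
next
  case (Suc m)
  then obtain l where l: "n = l + 1" "m < l" by (cases n) auto
  have "((\<lambda>u. (sin (u / 2))\<^sup>2 * (sin (u / 2))\<^sup>2 ^ m * cos (real (l + 1) * u))
    has_integral (0 / 2 - (0 + 0) / 4)) {0..2 * pi}"
    using l by (intro has_integral_sin_square_step Suc.IH) auto
  then show ?case
    unfolding l(1) by simp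
qed

text \<open>The classical formula \<open>2 * pi * (-1)^n * \<Gamma>(2\<mu>+1) / (4^\<mu> * \<Gamma>(\<mu>+n+1) * \<Gamma>(\<mu>-n+1))\<close> for the
  integral of \<open>sin^(2\<mu>) (u/2) * cos (n u)\<close> over a period vanishes at \<open>\<mu> = m < n\<close>; its
  \<open>\<mu>\<close>-derivative there is the value below.\<close>

definition log_moment :: "nat \<Rightarrow> nat \<Rightarrow> real" where
  "log_moment m n = - 2 * pi * (-1) ^ m * fact (2 * m) * fact (n - m - 1) / (4 ^ m * fact (n + m))"

text \<open>The closed form obeys the recursion of \<open>has_integral_sin_square_step\<close>.
  Writing \<open>n = m + 1 + j\<close> removes the truncated subtractions and turns every factorial
  into a multiple of \<open>fact j\<close>, \<open>fact (2 * m)\<close> or \<open>N\<close>.\<close>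

lemma log_moment_step:
  assumes "m < n"
  shows "log_moment m (n + 1) / 2 - (log_moment m (n + 2) + log_moment m n) / 4
    = log_moment (Suc m) (n + 1)"
proof -
  obtain j where n: "n = m + 1 + j" using assms less_iff_Suc_add by auto
  define N :: real where "N = fact (2 * m + j)"
  have i: "n + m = Suc (2 * m + j)" "n + 1 + m = Suc (Suc (2 * m + j))"
      "n + 2 + m = Suc (Suc (Suc (2 * m + j)))" "n + 1 + Suc m = Suc (Suc (Suc (2 * m + j)))"
      "2 * Suc m = Suc (Suc (2 * m))"
    by (simp_all add: n)
  have d: "n - m - 1 = j" "n + 1 - m - 1 = Suc j" "n + 2 - m - 1 = Suc (Suc j)" "n + 1 - Suc m - 1 = j"
    by (simp_all add: n)
  have "N > 0" by (simp add: N_def)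
  moreover have "real (Suc (2 * m + j)) > 0" "real (Suc (Suc (2 * m + j))) > 0"
      "real (Suc (Suc (Suc (2 * m + j)))) > 0" by simp_all
  ultimately show ?thesis
    unfolding log_moment_def d i fact_Suc N_def [symmetric]
    by (simp add: divide_simps del: of_nat_Suc) (simp add: algebra_simps)
qed

lemma has_integral_log_moment:
  assumes "m < n"
  shows "((\<lambda>u. (sin (u / 2))\<^sup>2 ^ m * ln ((sin (u / 2))\<^sup>2) * cos (real n * u))
    has_integral log_moment m n) {0..2 * pi}"
  using assms
proof (induction m arbitrary: n)
  case 0
  then obtain j where "n = Suc j" by (cases n) auto
  then show ?case using has_integral_ln_sin_cos[of n] by (simp add: log_moment_def divide_simps)
next
  case (Suc m)
  then obtain l where l: "n = l + 1" "m < l" by (cases n) auto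
  have "((\<lambda>u. (sin (u / 2))\<^sup>2 * ((sin (u / 2))\<^sup>2 ^ m * ln ((sin (u / 2))\<^sup>2)) * cos (real (l + 1) * u))
    has_integral (log_moment m (l + 1) / 2 - (log_moment m (l + 2) + log_moment m l) / 4)) {0..2 * pi}"
    using l by (intro has_integral_sin_square_step Suc.IH) auto
  then show ?case
    unfolding log_moment_step[OF l(2)] l(1) by (simp add: mult.assoc)
qed

subsection \<open>Fourier coefficients of the kernel series\<close>

definition bessel_coeff :: "nat \<Rightarrow> real" where
  "bessel_coeff m = (-1) ^ m / (fact m)\<^sup>2"

text \<open>On the circle, with \<open>|x - y| = 2 * |sin (u/2)|\<close> and \<open>w = sin\<^sup>2 (u/2)\<close>, the kernel is the sum over \<open>m\<close> of
  \<open>(-1)^m / (m!)\<^sup>2 * (k\<^sup>2 w)^m / (4 pi) * (1 + m * (ln (k\<^sup>2 w) + 2 \<gamma> - 2 * harm m - \<i> pi))\<close>.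
  The part depending on \<open>ln w\<close> is kept apart in \<open>np_term\<close>, since it alone contributes to the
  frequencies \<open>n > m\<close>. At \<open>w = 0\<close> the junk value \<open>ln 0 = 0\<close> gives the continuous extension.\<close>

definition np_coeff :: "real \<Rightarrow> nat \<Rightarrow> complex" where
  "np_coeff k m = Complex (1 + real m * (ln (k\<^sup>2) + 2 * euler_mascheroni) - 2 * real m * harm m) (- pi * real m)"

definition np_term :: "real \<Rightarrow> nat \<Rightarrow> real \<Rightarrow> complex" where
  "np_term k m u = of_real (bessel_coeff m * (k\<^sup>2) ^ m / (4 * pi)) *
     (np_coeff k m * of_real ((sin (u / 2))\<^sup>2 ^ m)
       + of_real (real m * ((sin (u / 2))\<^sup>2 ^ m * ln ((sin (u / 2))\<^sup>2))))"

definition np_kernel :: "real \<Rightarrow> real \<Rightarrow> complex" where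
  "np_kernel k u = (\<Sum>m. np_term k m u)"

text \<open>In the numerator, \<open>3 + \<bar>...\<bar> + pi\<close> comes from
  \<open>np_coeff\<close> and one more unit from the logarithmic part; \<open>4 * pi\<close> is the
  denominator of the prefactor in \<open>np_term\<close>.\<close>

definition np_bound :: "real \<Rightarrow> real" where
  "np_bound k = (4 + \<bar>ln (k\<^sup>2) + 2 * euler_mascheroni\<bar> + pi) / (4 * pi)"

section \<open>Uniform bounds and continuity of the kernel series\<close>

lemma np_bound_nonneg: "np_bound k \<ge> 0"
  by (simp add: np_bound_def)

text \<open>The inequality \<open>ln (1 / w) \<le> 1 / w - 1\<close> gives
  \<open>w * (- ln w) \<le> 1 - w\<close>, and higher powers of \<open>w\<close> only decrease the
  product.\<close>

lemma abs_power_mult_ln_le_1: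
  fixes w :: real
  assumes "0 \<le> w" "w \<le> 1" "m > 0"
  shows "\<bar>w ^ m * ln w\<bar> \<le> 1"
proof (cases "w = 0")
  case False
  then have w: "w > 0" using assms by simp
  have "- ln w \<le> 1 / w - 1"
    using ln_le_minus_one[of "1 / w"] w by (simp add: ln_div)
  then have "w * (- ln w) \<le> w * (1 / w - 1)"
    using w by (intro mult_left_mono) auto
  also have "\<dots> \<le> 1" using w by (simp add: algebra_simps)
  finally have 1: "w * (- ln w) \<le> 1" .
  have l: "ln w \<le> 0" using assms w by simp
  have "\<bar>w ^ m * ln w\<bar> = w ^ m * (- ln w)"
    using l w by (simp add: abs_mult)
  also have "\<dots> \<le> w ^ 1 * (- ln w)"
    using assms l by (intro mult_right_mono power_decreasing) auto
  finally show ?thesis using 1 by simp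
qed (use assms in auto)

lemma harm_le_nat: "harm m \<le> real m"
proof (induction m)
  case (Suc m)
  have "inverse (real (Suc m)) \<le> 1" by (simp add: field_simps)
  then show ?case using Suc by (simp add: harm_Suc)
qed (simp add: harm_def)

lemma real_le_two_power: "real m \<le> 2 ^ m"
  using less_exp[of m] by (metis less_imp_le of_nat_le_iff of_nat_numeral of_nat_power)

text \<open>The growth in \<open>m\<close> is at most quadratic, since
  \<open>harm m \<le> m\<close>. The cruder factor \<open>4 ^ m\<close> suffices against the
  factorials and keeps the majorant an exponential series.\<close>

lemma norm_np_coeff_le:
  "norm (np_coeff k m) \<le> (3 + \<bar>ln (k\<^sup>2) + 2 * euler_mascheroni\<bar> + pi) * 4 ^ m"
proof -
  define C where "C = \<bar>ln (k\<^sup>2) + 2 * euler_mascheroni\<bar>"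
  have m1: "1 \<le> (4::real) ^ m" by simp
  have m2: "real m \<le> 4 ^ m"
    using real_le_two_power[of m] power_mono[of "2::real" 4 m] by simp
  have m3: "real m * real m \<le> 4 ^ m"
  proof -
    have "real m * real m \<le> 2 ^ m * 2 ^ m" by (intro mult_mono real_le_two_power) auto
    then show ?thesis by (simp flip: power_mult_distrib)
  qed
  have h: "0 \<le> real m * harm m" "real m * harm m \<le> real m * real m"
    by (auto intro!: mult_left_mono harm_le_nat mult_nonneg_nonneg harm_nonneg)
  have "norm (np_coeff k m) \<le> \<bar>Re (np_coeff k m)\<bar> + \<bar>Im (np_coeff k m)\<bar>"
    by (rule cmod_le)
  also have "\<dots> \<le> 1 + real m * C + 2 * (real m * harm m) + pi * real m"
  proof -
    have "\<bar>real m * (ln (k\<^sup>2) + 2 * euler_mascheroni)\<bar> = real m * C"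
      by (simp add: abs_mult C_def)
    moreover have "\<bar>- pi * real m\<bar> = pi * real m" by (simp add: abs_mult)
    ultimately show ?thesis using h(1) by (simp add: np_coeff_def)
  qed
  also have "\<dots> \<le> 1 * 4 ^ m + 4 ^ m * C + 2 * 4 ^ m + pi * 4 ^ m"
    using m1 m2 m3 h by (intro add_mono mult_right_mono mult_left_mono) (auto simp: C_def)
  finally show ?thesis by (simp add: C_def algebra_simps)
qed

lemma abs_bessel_coeff: "\<bar>bessel_coeff m\<bar> = 1 / (fact m)\<^sup>2"
  by (simp add: bessel_coeff_def abs_divide power_abs)

lemma abs_bessel_coeff_le: "\<bar>bessel_coeff m\<bar> \<le> 1 / fact m"
  unfolding abs_bessel_coeff using fact_ge_1[of m, where 'a = real]
  by (simp add: power2_eq_square divide_simps)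

text \<open>A majorant free of \<open>u\<close> with an exponential series as sum: it yields uniform
  convergence, continuity and boundedness of the kernel.\<close>

lemma norm_np_term_le: "norm (np_term k m u) \<le> np_bound k * ((4 * k\<^sup>2) ^ m / fact m)"
proof -
  define C where "C = \<bar>ln (k\<^sup>2) + 2 * euler_mascheroni\<bar>"
  define w where "w = (sin (u / 2))\<^sup>2"
  have w: "0 \<le> w" "w \<le> 1"
    unfolding w_def by (auto simp: abs_square_le_1)
  have "norm (np_coeff k m * of_real (w ^ m)) \<le> ((3 + C + pi) * 4 ^ m) * 1"
    unfolding norm_mult using norm_np_coeff_le[of k m] w
    by (intro mult_mono) (auto simp: C_def power_le_one norm_power)
  moreover have "norm (complex_of_real (real m * (w ^ m * ln w))) \<le> 4 ^ m"
  proof (cases "m = 0")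
    case False
    have "norm (complex_of_real (real m * (w ^ m * ln w))) = real m * \<bar>w ^ m * ln w\<bar>"
      unfolding norm_of_real abs_mult[of "real m"] by simp
    also have "\<dots> \<le> 2 ^ m * 1"
      using abs_power_mult_ln_le_1[OF w, of m] False
      by (intro mult_mono real_le_two_power) auto
    also have "\<dots> \<le> 4 ^ m" using power_mono[of "2::real" 4 m] by simp
    finally show ?thesis .
  qed simp
  ultimately have "norm (np_coeff k m * of_real (w ^ m) + of_real (real m * (w ^ m * ln w)))
      \<le> (4 + C + pi) * 4 ^ m"
    by (intro norm_triangle_le) (simp add: algebra_simps)
  moreover have "norm (complex_of_real (bessel_coeff m * (k\<^sup>2) ^ m / (4 * pi))) \<le> 1 / fact m * (k\<^sup>2) ^ m / (4 * pi)"
    unfolding norm_of_real abs_divide abs_mult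
    using abs_bessel_coeff_le[of m] by (intro divide_mono mult_mono) auto
  ultimately have "norm (np_term k m u) \<le> (1 / fact m * (k\<^sup>2) ^ m / (4 * pi)) * ((4 + C + pi) * 4 ^ m)"
    unfolding np_term_def norm_mult w_def by (intro mult_mono) auto
  also have "\<dots> = np_bound k * ((4 * k\<^sup>2) ^ m / fact m)"
    by (simp add: np_bound_def C_def power_mult_distrib mult_ac)
  finally show ?thesis .
qed

lemma summable_power_div_fact: "summable (\<lambda>m. (x::real) ^ m / fact m)"
  using summable_exp[of x] by (simp add: field_simps)

lemma summable_np_term: "summable (\<lambda>m. np_term k m u)"
  by (rule summable_comparison_test'[OF summable_mult[OF summable_power_div_fact]])
     (rule norm_np_term_le)

lemma norm_np_kernel_le: "norm (np_kernel k u) \<le> np_bound k * exp (4 * k\<^sup>2)"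
proof -
  have "(\<lambda>m. np_bound k * ((4 * k\<^sup>2) ^ m / fact m)) sums (np_bound k * exp (4 * k\<^sup>2))"
    using exp_converges[of "4 * k\<^sup>2"] by (intro sums_mult) (simp add: field_simps)
  then show ?thesis
    unfolding np_kernel_def sums_iff
    using norm_suminf_le[of "\<lambda>m. np_term k m u" "\<lambda>m. np_bound k * ((4 * k\<^sup>2) ^ m / fact m)"]
      norm_np_term_le by auto
qed

lemma continuous_on_np_term: "continuous_on A (np_term k m)"
proof -
  have "continuous_on UNIV (\<lambda>v::real. v * ln (v\<^sup>2))"
    using isCont_mult_ln_square by (auto simp: continuous_on_eq_continuous_at)
  then have c: "continuous_on A (\<lambda>u. (\<lambda>v. v * ln (v\<^sup>2)) (sin (u / 2)))"
    by (rule continuous_on_compose2) (auto intro!: continuous_intros)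
  have "continuous_on A (\<lambda>u. real m * ((sin (u / 2))\<^sup>2 ^ m * ln ((sin (u / 2))\<^sup>2)))"
  \<comment> \<open>For \<open>m = 0\<close> the factor \<open>real m\<close> removes the logarithm.
    For \<open>m = Suc l\<close> one factor \<open>sin (u / 2)\<close> is joined to the logarithm to
    form the continuous \<open>v * ln (v\<^sup>2)\<close>.\<close>
  proof (cases m)
    case (Suc l)
    have "continuous_on A (\<lambda>u. real m * ((sin (u / 2))\<^sup>2 ^ l * sin (u / 2)))"
      by (intro continuous_intros) auto
    then have "continuous_on A (\<lambda>u. real m * ((sin (u / 2))\<^sup>2 ^ l * sin (u / 2)) *
        (sin (u / 2) * ln ((sin (u / 2))\<^sup>2)))"
      by (rule continuous_on_mult) (rule c)
    then show ?thesis
      by (simp add: Suc power2_eq_square mult_ac)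
  qed simp
  then have "continuous_on A (\<lambda>u. complex_of_real (real m * ((sin (u / 2))\<^sup>2 ^ m * ln ((sin (u / 2))\<^sup>2))))"
    by (rule continuous_on_of_real)
  moreover have "continuous_on A (\<lambda>u. np_coeff k m * of_real ((sin (u / 2))\<^sup>2 ^ m))"
    by (intro continuous_on_mult_left continuous_on_of_real continuous_on_power continuous_on_sin
        continuous_on_divide continuous_on_const continuous_on_id) simp
  ultimately show ?thesis
    unfolding np_term_def by - (rule continuous_on_mult_left, rule continuous_on_add)
qed

lemma uniform_limit_np_kernel:
  "uniform_limit A (\<lambda>N u. \<Sum>m<N. np_term k m u) (np_kernel k) sequentially"
  unfolding np_kernel_def
  by (rule Weierstrass_m_test[OF _ summable_mult[OF summable_power_div_fact]]) (rule norm_np_term_le)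

lemma continuous_on_np_kernel: "continuous_on A (np_kernel k)"
  by (rule uniform_limit_theorem[OF _ uniform_limit_np_kernel])
     (auto intro!: always_eventually continuous_on_sum continuous_on_np_term)

section \<open>Cosine coefficients of the kernel, term by term\<close>

definition np_fourier :: "real \<Rightarrow> nat \<Rightarrow> nat \<Rightarrow> complex" where
  "np_fourier k n m = integral {0..2 * pi} (\<lambda>u. np_term k m u * of_real (cos (real n * u)))"

lemma has_integral_np_fourier:
  "((\<lambda>u. np_term k m u * of_real (cos (real n * u))) has_integral np_fourier k n m) {0..2 * pi}"
  unfolding np_fourier_def
  by (intro integrable_integral integrable_continuous_interval continuous_on_mult continuous_on_np_term
      continuous_intros)

lemma norm_np_fourier_le:
  "norm (np_fourier k n m) \<le> 2 * pi * np_bound k * ((4 * k\<^sup>2) ^ m / fact m)"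
proof -
  have "norm (np_fourier k n m) \<le> np_bound k * ((4 * k\<^sup>2) ^ m / fact m) * measure lborel (cbox 0 (2 * pi))"
  proof (rule has_integral_bound)
    fix u
    have "norm (np_term k m u) * \<bar>cos (real n * u)\<bar> \<le> np_bound k * ((4 * k\<^sup>2) ^ m / fact m) * 1"
      using norm_np_term_le by (intro mult_mono) (auto simp: np_bound_nonneg)
    then show "norm (np_term k m u * of_real (cos (real n * u))) \<le> np_bound k * ((4 * k\<^sup>2) ^ m / fact m)"
      by (simp add: norm_mult)
  qed (use has_integral_np_fourier np_bound_nonneg in auto)
  then show ?thesis by (simp add: mult_ac)
qed

text \<open>Termwise integration, justified by uniform convergence on the period.\<close>

lemma np_fourier_sums:
  "np_fourier k n sums integral {0..2 * pi} (\<lambda>u. np_kernel k u * of_real (cos (real n * u)))"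
proof -
  have "norm (np_term k m u * of_real (cos (real n * u))) \<le> np_bound k * ((4 * k\<^sup>2) ^ m / fact m)" for m u
  proof -
    have "norm (np_term k m u) * \<bar>cos (real n * u)\<bar> \<le> np_bound k * ((4 * k\<^sup>2) ^ m / fact m) * 1"
      using norm_np_term_le by (intro mult_mono) (auto simp: np_bound_nonneg)
    then show ?thesis by (simp add: norm_mult)
  qed
  then have "uniform_limit {0..2 * pi} (\<lambda>N u. \<Sum>m<N. np_term k m u * of_real (cos (real n * u)))
      (\<lambda>u. \<Sum>m. np_term k m u * of_real (cos (real n * u))) sequentially"
    by (intro Weierstrass_m_test[OF _ summable_mult[OF summable_power_div_fact]])
  moreover have "(\<lambda>u. \<Sum>m. np_term k m u * of_real (cos (real n * u)))
      = (\<lambda>u. np_kernel k u * of_real (cos (real n * u)))"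
    unfolding np_kernel_def using suminf_mult2[OF summable_np_term] by metis
  ultimately obtain I J where IJ:
    "\<And>N. ((\<lambda>u. \<Sum>m<N. np_term k m u * of_real (cos (real n * u))) has_integral I N) {0..2 * pi}"
    "((\<lambda>u. np_kernel k u * of_real (cos (real n * u))) has_integral J) {0..2 * pi}" "I \<longlonglongrightarrow> J"
    by (auto elim!: uniform_limit_integral
        intro!: continuous_on_sum continuous_on_mult continuous_on_np_term continuous_intros)
  have "I N = (\<Sum>m<N. np_fourier k n m)" for N
    by (rule has_integral_unique[OF IJ(1)]) (intro has_integral_sum has_integral_np_fourier finite_lessThan)
  then have "I = (\<lambda>N. \<Sum>m<N. np_fourier k n m)" by blast
  then show ?thesis
    using IJ(2,3) by (simp add: sums_def integral_unique)
qed

text \<open>All of \<open>np_coeff\<close>, including its imaginary part and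
  \<open>ln (k\<^sup>2)\<close>, multiplies \<open>sin^(2m) (u/2)\<close> and is lost by
  orthogonality; only the real logarithmic moment survives.\<close>

lemma np_fourier_eq_log_moment:
  assumes "m < n"
  shows "np_fourier k n m = of_real (bessel_coeff m * (k\<^sup>2) ^ m / (4 * pi) * real m * log_moment m n)"
proof -
  have "((\<lambda>u. of_real (bessel_coeff m * (k\<^sup>2) ^ m / (4 * pi)) *
      (np_coeff k m * of_real ((sin (u / 2))\<^sup>2 ^ m * cos (real n * u))
       + of_real (real m) * of_real ((sin (u / 2))\<^sup>2 ^ m * ln ((sin (u / 2))\<^sup>2) * cos (real n * u))))
    has_integral of_real (bessel_coeff m * (k\<^sup>2) ^ m / (4 * pi)) *
      (np_coeff k m * of_real 0 + of_real (real m) * of_real (log_moment m n))) {0..2 * pi}"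
    using has_integral_linear[OF has_integral_sin_power_cos_zero[OF assms] bounded_linear_of_real]
      has_integral_linear[OF has_integral_log_moment[OF assms] bounded_linear_of_real]
    unfolding o_def by (intro has_integral_mult_right has_integral_add)
  then have "((\<lambda>u. np_term k m u * of_real (cos (real n * u))) has_integral
      of_real (bessel_coeff m * (k\<^sup>2) ^ m / (4 * pi) * real m * log_moment m n)) {0..2 * pi}"
    by (simp add: np_term_def algebra_simps)
  then show ?thesis
    using has_integral_np_fourier has_integral_unique by blast
qed

text \<open>The term \<open>m = 0\<close> of the kernel is the constant \<open>1 / (4 pi)\<close>,
  the Neumann-Poincare kernel of the Laplacian on the disk.\<close>

lemma np_fourier_0: "np_fourier k n 0 = (if n = 0 then 1 / 2 else 0)"
proof -
  have "((\<lambda>u. of_real (1 / (4 * pi) * cos (real n * u))) has_integral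
      (of_real (1 / (4 * pi) * (if n = 0 then 2 * pi else 0)) :: complex)) {0..2 * pi}"
    using has_integral_linear[OF has_integral_mult_right[OF has_integral_cos_nat] bounded_linear_of_real]
    unfolding o_def .
  moreover have "of_real (1 / (4 * pi) * cos (real n * u)) = np_term k 0 u * of_real (cos (real n * u))" for u
    by (simp add: np_term_def bessel_coeff_def np_coeff_def complex_eq_iff)
  ultimately have "((\<lambda>u. np_term k 0 u * of_real (cos (real n * u))) has_integral
      of_real (1 / (4 * pi) * (if n = 0 then 2 * pi else 0))) {0..2 * pi}"
    by simp
  then have "np_fourier k n 0 = of_real (1 / (4 * pi) * (if n = 0 then 2 * pi else 0))"
    by (rule has_integral_unique[OF has_integral_np_fourier])
  then show ?thesis by simp
qed

subsection \<open>The normal derivative of the fundamental solution\<close>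

lemma summable_powser_fact_bound:
  fixes c :: "nat \<Rightarrow> real"
  assumes "\<And>m. \<bar>c m\<bar> \<le> 4 ^ m / fact m"
  shows "summable (\<lambda>m. c m * y ^ m)"
proof (rule summable_comparison_test'[OF summable_power_div_fact[of "4 * \<bar>y\<bar>"]])
  fix m :: nat
  show "norm (c m * y ^ m) \<le> (4 * \<bar>y\<bar>) ^ m / fact m"
    using mult_right_mono[OF assms[of m], of "\<bar>y\<bar> ^ m"]
    by (simp add: abs_mult power_abs power_mult_distrib)
qed

text \<open>The operator \<open>s d/ds\<close> multiplies the coefficient of \<open>s ^ m\<close> by
  \<open>m\<close>; this is the origin of the factors \<open>m\<close> in
  \<open>np_term\<close>.\<close>

lemma powser_diffs_sums:
  fixes c :: "nat \<Rightarrow> real"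
  assumes "\<And>y. summable (\<lambda>m. c m * y ^ m)"
  shows "(\<lambda>m. real m * c m * s ^ m) sums (s * (\<Sum>m. diffs c m * s ^ m))"
proof -
  have "(\<lambda>m. s * (real m * c m * s ^ (m - Suc 0))) sums (s * (\<Sum>m. diffs c m * s ^ m))"
    by (intro sums_mult diffs_equiv termdiff_converges_all assms)
  moreover have "s * (real m * c m * s ^ (m - Suc 0)) = real m * c m * s ^ m" for m
    by (cases m) auto
  ultimately show ?thesis by simp
qed

definition bessel_coeff_harm :: "nat \<Rightarrow> real" where
  "bessel_coeff_harm m = bessel_coeff m * harm m"

lemma summable_bessel_coeff: "summable (\<lambda>m. bessel_coeff m * y ^ m)"
proof (rule summable_powser_fact_bound)
  fix m show "\<bar>bessel_coeff m\<bar> \<le> 4 ^ m / fact m"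
    using abs_bessel_coeff_le[of m] divide_right_mono[of 1 "4 ^ m :: real" "fact m"] by simp
qed

lemma summable_bessel_coeff_harm: "summable (\<lambda>m. bessel_coeff_harm m * y ^ m)"
proof (rule summable_powser_fact_bound)
  fix m
  have "harm m \<le> (4::real) ^ m"
    using harm_le_nat[of m] real_le_two_power[of m] power_mono[of "2::real" 4 m] by linarith
  then have "\<bar>bessel_coeff m\<bar> * harm m \<le> 1 / fact m * 4 ^ m"
    by (intro mult_mono abs_bessel_coeff_le harm_nonneg) auto
  then show "\<bar>bessel_coeff_harm m\<bar> \<le> 4 ^ m / fact m"
    by (simp add: bessel_coeff_harm_def abs_mult)
qed

text \<open>The fundamental solution as a function of \<open>s = k\<^sup>2 |x|\<^sup>2 / 4\<close>; in this variable all
  ingredients are entire apart from the logarithm.\<close>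

definition radial_G :: "real \<Rightarrow> complex" where
  "radial_G s = Complex
     ((ln s + 2 * euler_mascheroni) * (\<Sum>m. bessel_coeff m * s ^ m) / (4 * pi)
        - (\<Sum>m. bessel_coeff_harm m * s ^ m) / (2 * pi))
     (- (\<Sum>m. bessel_coeff m * s ^ m) / 4)"

definition radial_G_deriv :: "real \<Rightarrow> complex" where
  "radial_G_deriv s = Complex
     (((\<Sum>m. bessel_coeff m * s ^ m) / s
         + (ln s + 2 * euler_mascheroni) * (\<Sum>m. diffs bessel_coeff m * s ^ m)) / (4 * pi)
        - (\<Sum>m. diffs bessel_coeff_harm m * s ^ m) / (2 * pi))
     (- (\<Sum>m. diffs bessel_coeff m * s ^ m) / 4)"

lemma has_vector_derivative_radial_G:
  assumes "s > 0"
  shows "(radial_G has_vector_derivative radial_G_deriv s) (at s)"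
proof -
  note d = termdiffs_strong_converges_everywhere[OF summable_bessel_coeff]
    termdiffs_strong_converges_everywhere[OF summable_bessel_coeff_harm]
  show ?thesis
    unfolding has_vector_derivative_complex_iff radial_G_def radial_G_deriv_def
    using assms by (auto intro!: derivative_eq_intros d simp: field_simps)
qed

text \<open>The factor \<open>- \<i> / 4\<close> turns \<open>J + \<i> Y\<close> into
  \<open>Y / 4 - \<i> J / 4\<close>, and \<open>ln (k |z| / 2) = ln s / 2\<close>.\<close>

lemma helmholtz_G_eq_radial_G:
  assumes "k > 0" "z \<noteq> 0"
  shows "helmholtz_G k z = radial_G (k\<^sup>2 * (norm z)\<^sup>2 / 4)"
proof -
  define s where "s = k\<^sup>2 * (norm z)\<^sup>2 / 4"
  have s: "s = (k * norm z / 2)\<^sup>2" "(k * norm z)\<^sup>2 / 4 = s"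
    by (simp_all add: s_def power_mult_distrib power_divide)
  have "ln (k * norm z / 2) = ln s / 2"
    unfolding s(1) using assms by (subst ln_realpow) auto
  moreover have "bessel_J0 (k * norm z) = (\<Sum>m. bessel_coeff m * s ^ m)"
    by (simp add: bessel_J0_def bessel_coeff_def s(2))
  moreover have "(\<Sum>m. (-1) ^ m * harm m * ((k * norm z)\<^sup>2 / 4) ^ m / (fact m)\<^sup>2)
      = (\<Sum>m. bessel_coeff_harm m * s ^ m)"
    by (simp add: bessel_coeff_harm_def bessel_coeff_def s(2) mult_ac)
  ultimately show ?thesis
    unfolding helmholtz_G_def hankel1_0_def bessel_Y0_def s_def [symmetric] radial_G_def
    by (simp add: complex_eq_iff field_simps)
qed

lemma normal_deriv_G_eq:
  assumes "k > 0" "y \<noteq> x"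
  shows "normal_deriv_G k x y =
    (k\<^sup>2 * ((x - y) \<bullet> x) / 2) *\<^sub>R radial_G_deriv (k\<^sup>2 * (norm (x - y))\<^sup>2 / 4)"
proof -
  define z where "z = x - y"
  have z: "z \<noteq> 0" using assms by (simp add: z_def)
  define s where "s = (\<lambda>t::real. k\<^sup>2 * (norm (z + t *\<^sub>R x))\<^sup>2 / 4)"
  have "(s has_real_derivative (k\<^sup>2 * (z \<bullet> x) / 2)) (at 0)"
    unfolding s_def power2_norm_eq_inner inner_add_left inner_add_right inner_scaleR_left inner_scaleR_right
    by (auto intro!: derivative_eq_intros simp: inner_commute algebra_simps)
  moreover have "s 0 = k\<^sup>2 * (norm z)\<^sup>2 / 4" by (simp add: s_def)
  moreover have "s 0 > 0" using assms z by (simp add: s_def)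
  ultimately have "(radial_G \<circ> s has_vector_derivative
      (k\<^sup>2 * (z \<bullet> x) / 2) *\<^sub>R radial_G_deriv (k\<^sup>2 * (norm z)\<^sup>2 / 4)) (at 0)"
    using vector_diff_chain_at[of s "k\<^sup>2 * (z \<bullet> x) / 2" 0 radial_G]
      has_vector_derivative_radial_G[of "s 0"]
    by (simp only: has_real_derivative_iff_has_vector_derivative)
  \<comment> \<open>The radial form is available only away from the origin, so the functions are
    exchanged on an open set of parameters around 0.\<close>
  moreover have "open {t::real. z + t *\<^sub>R x \<noteq> 0}"
    by (intro open_Collect_neq continuous_intros)
  ultimately have "((\<lambda>t. helmholtz_G k (z + t *\<^sub>R x)) has_vector_derivative
      (k\<^sup>2 * (z \<bullet> x) / 2) *\<^sub>R radial_G_deriv (k\<^sup>2 * (norm z)\<^sup>2 / 4)) (at 0)"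
    by (rule has_vector_derivative_transform_within_open)
       (use assms z in \<open>auto simp: helmholtz_G_eq_radial_G s_def\<close>)
  moreover have "(\<lambda>t. helmholtz_G k (x + t *\<^sub>R disk_normal x - y)) = (\<lambda>t. helmholtz_G k (z + t *\<^sub>R x))"
    by (simp add: z_def disk_normal_def algebra_simps)
  ultimately show ?thesis
    unfolding normal_deriv_G_def z_def [symmetric] by (simp add: vector_derivative_at)
qed

section \<open>The kernel restricted to the circle\<close>

lemma norm_cis_diff_squared: "(norm (cis a - cis b))\<^sup>2 = 4 * (sin ((b - a) / 2))\<^sup>2"
proof -
  have "(norm (cis a - cis b))\<^sup>2 = 2 - 2 * cos (b - a)"
    unfolding cmod_power2 using sin_cos_squared_add[of a] sin_cos_squared_add[of b]
    by (simp add: power2_diff cos_diff algebra_simps)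
  also have "cos (b - a) = 1 - 2 * (sin ((b - a) / 2))\<^sup>2"
    using cos_double_sin[of "(b - a) / 2"] by (simp only: mult_2 field_sum_of_halves)
  finally show ?thesis by simp
qed

text \<open>Applying \<open>s d/ds\<close> to the series of \<open>radial_G\<close> and splitting
  \<open>ln s = ln (k\<^sup>2) + ln w\<close> gives the terms \<open>np_term\<close>, real and
  imaginary parts separately.\<close>

lemma np_kernel_eq_radial_G_deriv:
  assumes "k > 0" "s = k\<^sup>2 * (sin (u / 2))\<^sup>2" "s > 0"
  shows "np_kernel k u = s *\<^sub>R radial_G_deriv s"
proof -
  define w where "w = (sin (u / 2))\<^sup>2"
  have s: "s = k\<^sup>2 * w" "w > 0"
    using assms zero_less_mult_iff[of "k\<^sup>2" w] by (auto simp: w_def)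
  have l: "ln s = ln (k\<^sup>2) + ln w"
    using assms s by (simp add: ln_mult)
  have "(\<lambda>m. (bessel_coeff m * s ^ m + (ln s + 2 * euler_mascheroni) * (real m * bessel_coeff m * s ^ m)) / (4 * pi)
      - (real m * bessel_coeff_harm m * s ^ m) / (2 * pi)) sums
      (((\<Sum>m. bessel_coeff m * s ^ m) + (ln s + 2 * euler_mascheroni) * (s * (\<Sum>m. diffs bessel_coeff m * s ^ m))) / (4 * pi)
        - s * (\<Sum>m. diffs bessel_coeff_harm m * s ^ m) / (2 * pi))"
    by (intro sums_diff sums_divide sums_add sums_mult powser_diffs_sums summable_sums
        summable_bessel_coeff summable_bessel_coeff_harm)
  moreover have "\<dots> = Re (s *\<^sub>R radial_G_deriv s)"
    using \<open>s > 0\<close> by (simp add: radial_G_deriv_def field_simps)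
  moreover have "(\<lambda>m. - (real m * bessel_coeff m * s ^ m) / 4) sums
      (- (s * (\<Sum>m. diffs bessel_coeff m * s ^ m)) / 4)"
    by (intro sums_divide sums_minus powser_diffs_sums summable_bessel_coeff)
  moreover have "\<dots> = Im (s *\<^sub>R radial_G_deriv s)"
    by (simp add: radial_G_deriv_def)
  moreover have "Re (np_term k m u) = (bessel_coeff m * s ^ m + (ln s + 2 * euler_mascheroni) * (real m * bessel_coeff m * s ^ m)) / (4 * pi)
      - (real m * bessel_coeff_harm m * s ^ m) / (2 * pi)" for m
    unfolding np_term_def np_coeff_def w_def [symmetric] l unfolding s(1) power_mult_distrib bessel_coeff_harm_def
    by (simp add: field_simps)
  moreover have "Im (np_term k m u) = - (real m * bessel_coeff m * s ^ m) / 4" for m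
    unfolding np_term_def np_coeff_def w_def [symmetric] s(1) power_mult_distrib
    by (simp add: field_simps)
  ultimately have "(\<lambda>m. np_term k m u) sums (s *\<^sub>R radial_G_deriv s)"
    unfolding sums_complex_iff by simp
  then show ?thesis by (simp add: np_kernel_def sums_iff)
qed

text \<open>For \<open>|x| = |y| = 1\<close> one has \<open>(x - y) \<bullet> x = |x - y|\<^sup>2 / 2\<close>, which cancels the singularity.\<close>

lemma normal_deriv_G_cis:
  assumes "k > 0" "cis b \<noteq> cis a"
  shows "normal_deriv_G k (cis a) (cis b) = np_kernel k (b - a)"
proof -
  define s where "s = k\<^sup>2 * (sin ((b - a) / 2))\<^sup>2"
  have n: "(norm (cis a - cis b))\<^sup>2 = 4 * (sin ((b - a) / 2))\<^sup>2"
    by (rule norm_cis_diff_squared)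
  have "(cis a - cis b) \<bullet> cis a = (norm (cis a - cis b))\<^sup>2 / 2"
    by (simp add: power2_norm_eq_inner inner_diff_left inner_diff_right inner_commute)
       (simp add: power2_norm_eq_inner [symmetric])
  then have "k\<^sup>2 * ((cis a - cis b) \<bullet> cis a) / 2 = s" "k\<^sup>2 * (norm (cis a - cis b))\<^sup>2 / 4 = s"
    by (simp_all add: n s_def)
  moreover have "(norm (cis a - cis b))\<^sup>2 > 0" using assms by simp
  then have "s > 0"
    unfolding n using assms by (simp add: s_def)
  ultimately show ?thesis
    using assms by (simp add: normal_deriv_G_eq np_kernel_eq_radial_G_deriv[OF _ s_def])
qed

section \<open>Convolution with the kernel over one period\<close>

lemma integral_periodic_shift:
  fixes g :: "real \<Rightarrow> 'a::euclidean_space"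
  assumes "continuous_on UNIV g" "\<And>u. g (u + p) = g u" "0 \<le> t" "t \<le> p"
  shows "integral {0..p} (\<lambda>\<theta>. g (\<theta> - t)) = integral {0..p} g"
proof -
  have int: "g integrable_on {a..b}" for a b
    by (rule integrable_continuous_interval) (rule continuous_on_subset[OF assms(1)], simp)
  have "integral {0..p} (\<lambda>\<theta>. g (\<theta> - t)) = integral {-t..p - t} g"
    using integral_shift_real_ivl[of 0 t p "\<lambda>\<theta>. g (\<theta> - t)"] by simp
  also have "\<dots> = integral {-t..0} g + integral {0..p - t} g"
    using assms by (intro Henstock_Kurzweil_Integration.integral_combine [symmetric] int) auto
  also have "integral {-t..0} g = integral {p - t..p} g"
    using integral_shift_real_ivl[of "p - t" p p g] assms(2) by simp
  also have "integral {p - t..p} g + integral {0..p - t} g = integral {0..p} g"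
    using assms Henstock_Kurzweil_Integration.integral_combine[OF _ _ int, of 0 "p - t" p] by (simp add: add.commute)
  finally show ?thesis .
qed

text \<open>Reflection followed by a shift by one period shows that the integral equals its own
  negative.\<close>

lemma integral_periodic_odd:
  fixes g :: "real \<Rightarrow> 'a::euclidean_space"
  assumes "\<And>u. g (u + p) = g u" "\<And>u. g (- u) = - g u"
  shows "integral {0..p} g = 0"
proof -
  have "integral {0..p} g = integral {-p..0} (\<lambda>u. g (- u))"
    using Henstock_Kurzweil_Integration.integral_reflect_real[of p 0 g] by simp
  also have "\<dots> = - integral {-p..0} g" by (simp add: assms(2))
  also have "integral {-p..0} g = integral {0..p} g"
    using integral_shift_real_ivl[of 0 p p g] assms(1) by simp
  finally show ?thesis by (simp add: eq_neg_iff_add_eq_0 flip: scaleR_2)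
qed

lemma np_kernel_minus: "np_kernel k (- u) = np_kernel k u"
  by (simp add: np_kernel_def np_term_def)

lemma np_kernel_periodic: "np_kernel k (u + 2 * pi) = np_kernel k u"
proof -
  have "sin ((u + 2 * pi) / 2) = - sin (u / 2)"
    using sin_periodic_pi[of "u / 2"] by (simp add: add_divide_distrib)
  then show ?thesis by (simp add: np_kernel_def np_term_def)
qed

lemma cis_periodic: "cis (real n * (u + 2 * pi)) = cis (real n * u)"
proof -
  have "cis (real n * (u + 2 * pi)) = cis (real n * u) * cis (2 * pi * real n)"
    by (simp add: cis_mult algebra_simps)
  then show ?thesis by (simp add: cis_multiple_2pi)
qed

text \<open>The operator is a convolution on the circle, so exponentials are eigenfunctions:
  shifting by \<open>t\<close> releases the factor \<open>cis (n t)\<close>, and evenness of the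
  kernel kills the sine part.\<close>

lemma integral_np_kernel_shift:
  assumes "0 \<le> t" "t \<le> 2 * pi"
  shows "integral {0..2 * pi} (\<lambda>\<theta>. np_kernel k (\<theta> - t) * cis (real n * \<theta>))
    = integral {0..2 * pi} (\<lambda>u. np_kernel k u * of_real (cos (real n * u))) * cis (real n * t)"
proof -
  define g where "g = (\<lambda>u. np_kernel k u * cis (real n * u))"
  have cont: "continuous_on A g" for A
    unfolding g_def by (intro continuous_on_mult continuous_on_np_kernel) (intro continuous_intros)
  have per: "g (u + 2 * pi) = g u" for u
    unfolding g_def np_kernel_periodic cis_periodic ..
  have "(\<lambda>\<theta>. np_kernel k (\<theta> - t) * cis (real n * \<theta>)) = (\<lambda>\<theta>. g (\<theta> - t) * cis (real n * t))"
    by (simp add: g_def mult.assoc cis_mult right_diff_distrib)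
  then have "integral {0..2 * pi} (\<lambda>\<theta>. np_kernel k (\<theta> - t) * cis (real n * \<theta>))
      = integral {0..2 * pi} (\<lambda>\<theta>. g (\<theta> - t)) * cis (real n * t)"
    by simp
  also have "integral {0..2 * pi} (\<lambda>\<theta>. g (\<theta> - t)) = integral {0..2 * pi} g"
    using assms cont per by (intro integral_periodic_shift)
  also have "integral {0..2 * pi} g = integral {0..2 * pi}
      (\<lambda>u. np_kernel k u * of_real (cos (real n * u)) + np_kernel k u * (\<i> * of_real (sin (real n * u))))"
    by (simp add: g_def cis_conv_exp exp_Euler distrib_left flip: cos_of_real sin_of_real)
  also have "\<dots> = integral {0..2 * pi} (\<lambda>u. np_kernel k u * of_real (cos (real n * u)))
      + integral {0..2 * pi} (\<lambda>u. np_kernel k u * (\<i> * of_real (sin (real n * u))))"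
    by (intro integral_add integrable_continuous_interval continuous_on_mult continuous_on_np_kernel)
       (intro continuous_intros)+
  also have "integral {0..2 * pi} (\<lambda>u. np_kernel k u * (\<i> * of_real (sin (real n * u)))) = 0"
  proof (rule integral_periodic_odd)
    fix u
    have "sin (real n * (u + 2 * pi)) = sin (real n * u)"
      using cis_periodic[of n u] by (simp add: complex_eq_iff)
    then show "np_kernel k (u + 2 * pi) * (\<i> * of_real (sin (real n * (u + 2 * pi))))
      = np_kernel k u * (\<i> * of_real (sin (real n * u)))"
      by (simp only: np_kernel_periodic)
  qed (simp add: np_kernel_minus)
  finally show ?thesis by simp
qed

subsection \<open>The principal value\<close>

text \<open>A form without \<open>Arg\<close>, from which Borel measurability on the whole plane
  follows. At the origin \<open>Arg 0 = 0\<close> yields the value 1.\<close>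

lemma circle_exp_eq: "circle_exp n y = (if y = 0 then 1 else sgn y ^ n)"
proof -
  have "circle_exp n y = cis (Arg y) ^ n"
    by (simp add: circle_exp_def cis_conv_exp exp_of_nat_mult [symmetric] mult_ac)
  then show ?thesis by (simp add: cis_Arg Arg_zero)
qed

lemma borel_measurable_circle_exp [measurable]: "circle_exp n \<in> borel_measurable borel"
  unfolding circle_exp_eq [abs_def] sgn_div_norm by measurable

lemma circle_exp_cis_eq_cis: "circle_exp n (cis \<theta>) = cis (real n * \<theta>)"
  using circle_exp_cis[of n \<theta>] by (simp add: cis_conv_exp mult_ac)

lemma borel_measurable_powser:
  fixes c :: "nat \<Rightarrow> real"
  assumes "\<And>y. summable (\<lambda>m. c m * y ^ m)"
  shows "(\<lambda>s. \<Sum>m. c m * s ^ m) \<in> borel_measurable borel"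
  by (intro borel_measurable_continuous_onI continuous_at_imp_continuous_on ballI
      isCont_powser_converges_everywhere assms)

lemma borel_measurable_radial_G_deriv [measurable]: "radial_G_deriv \<in> borel_measurable borel"
proof -
  note [measurable] = borel_measurable_powser[OF summable_bessel_coeff]
    borel_measurable_powser[OF termdiff_converges_all[OF summable_bessel_coeff]]
    borel_measurable_powser[OF termdiff_converges_all[OF summable_bessel_coeff_harm]]
  show ?thesis
    unfolding borel_measurable_complex_iff radial_G_deriv_def complex.sel
    by (intro conjI; measurable)
qed

text \<open>Equal points have chord length 0, hence \<open>sin ((b - a) / 2) = 0\<close> with an
  argument strictly between \<open>- pi\<close> and \<open>pi\<close>.\<close>

lemma cis_neq:
  assumes "0 \<le> a" "a < 2 * pi" "0 \<le> b" "b < 2 * pi" "a \<noteq> b"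
  shows "cis a \<noteq> cis b"
proof
  assume "cis a = cis b"
  then have "sin ((b - a) / 2) = 0"
    using norm_cis_diff_squared[of a b] by simp
  moreover have "- pi < (b - a) / 2" "(b - a) / 2 < pi"
    using assms by auto
  ultimately have "(b - a) / 2 = 0"
    using sin_eq_0_pi by blast
  then show False using assms by simp
qed

lemma truncated_neumann_poincare_eq:
  assumes "k > 0" "\<epsilon> > 0"
  shows "(LINT y:{y. \<epsilon> < dist (cis t) y}|circle_arclength. normal_deriv_G k (cis t) y * circle_exp n y)
    = (LINT \<theta>|lborel. indicator {0..<2 * pi} \<theta> *\<^sub>R (indicator {\<theta>. \<epsilon> < dist (cis t) (cis \<theta>)} \<theta> *\<^sub>R
        (np_kernel k (\<theta> - t) * cis (real n * \<theta>))))"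
proof -
  define x where "x = cis t"
  \<comment> \<open>The explicit formula for the normal derivative replaces
    \<open>vector_derivative\<close>, so that \<open>F\<close> is evidently measurable. The formula
    fails to apply only at \<open>y = x\<close>, which the truncation excludes.\<close>
  define F where "F = (\<lambda>y. indicator {y. \<epsilon> < dist x y} y *\<^sub>R
    ((k\<^sup>2 * ((x - y) \<bullet> x) / 2) *\<^sub>R radial_G_deriv (k\<^sup>2 * (norm (x - y))\<^sup>2 / 4) * circle_exp n y))"
  have F: "indicator {y. \<epsilon> < dist x y} y *\<^sub>R (normal_deriv_G k x y * circle_exp n y) = F y" for y
  proof (cases "\<epsilon> < dist x y")
    case True
    then have "y \<noteq> x" using assms by auto
    then show ?thesis by (simp add: F_def normal_deriv_G_eq[OF assms(1)])
  qed (simp add: F_def)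
  have F_cis: "F (cis \<theta>) = indicator {\<theta>. \<epsilon> < dist x (cis \<theta>)} \<theta> *\<^sub>R
      (np_kernel k (\<theta> - t) * cis (real n * \<theta>))" for \<theta>
  proof (cases "\<epsilon> < dist x (cis \<theta>)")
    case True
    then have "cis \<theta> \<noteq> cis t" using assms by (auto simp: x_def)
    then show ?thesis
      unfolding F [symmetric] using True
      by (simp add: x_def normal_deriv_G_cis[OF assms(1)] circle_exp_cis_eq_cis)
  qed (simp add: F_def)
  have [measurable]: "F \<in> borel_measurable borel"
    unfolding F_def by measurable
  have [measurable]: "cis \<in> borel_measurable borel"
    by (intro borel_measurable_continuous_onI continuous_intros)
  have "(LINT y:{y. \<epsilon> < dist x y}|circle_arclength. normal_deriv_G k x y * circle_exp n y)
      = (LINT y|circle_arclength. F y)"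
    unfolding set_lebesgue_integral_def F ..
  also have "\<dots> = (LINT \<theta>|restrict_space lborel {0..<2 * pi}. F (cis \<theta>))"
    unfolding circle_arclength_def by (intro integral_distr measurable_restrict_space1) measurable
  also have "\<dots> = (LINT \<theta>|lborel. indicator {0..<2 * pi} \<theta> *\<^sub>R F (cis \<theta>))"
    by (intro integral_restrict_space) auto
  finally show ?thesis unfolding F_cis by (simp only: x_def)
qed

text \<open>The kernel is bounded and the removed arc shrinks to one point, so dominated convergence
  identifies the principal value with the full integral.\<close>

lemma neumann_poincare_circle_exp:
  assumes "k > 0" "0 \<le> t" "t < 2 * pi"
  shows "neumann_poincare k (circle_exp n) (cis t) = (\<Sum>m. np_fourier k n m) * circle_exp n (cis t)"
proof -
  define h where "h = (\<lambda>\<theta>. np_kernel k (\<theta> - t) * cis (real n * \<theta>))"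
  have cont: "continuous_on A h" for A
    unfolding h_def
    by (intro continuous_on_mult continuous_on_compose2[OF continuous_on_np_kernel[where A = UNIV]])
       (intro continuous_intros | simp)+
  have [measurable]: "h \<in> borel_measurable borel"
    by (intro borel_measurable_continuous_onI cont)
  have [measurable]: "cis \<in> borel_measurable borel"
    by (intro borel_measurable_continuous_onI continuous_intros)
  have hb: "norm (h \<theta>) \<le> np_bound k * exp (4 * k\<^sup>2)" for \<theta>
    using norm_np_kernel_le by (simp add: h_def norm_mult)
  define X where "X = (\<lambda>\<epsilon>. LINT y:{y. \<epsilon> < dist (cis t) y}|circle_arclength.
    normal_deriv_G k (cis t) y * circle_exp n y)"
  have "(X \<longlongrightarrow> (LINT \<theta>|lborel. indicator {0..2 * pi} \<theta> *\<^sub>R h \<theta>)) (at_right 0)"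
  proof (rule tendsto_at_right_sequentially[of 0 1])
    fix S :: "nat \<Rightarrow> real"
    assume S: "\<And>i. 0 < S i" "S \<longlonglongrightarrow> 0"
    have "(\<lambda>i. LINT \<theta>|lborel. indicator {0..<2 * pi} \<theta> *\<^sub>R
        (indicator {\<theta>. S i < dist (cis t) (cis \<theta>)} \<theta> *\<^sub>R h \<theta>))
      \<longlonglongrightarrow> (LINT \<theta>|lborel. indicator {0..2 * pi} \<theta> *\<^sub>R h \<theta>)"
    proof (rule integral_dominated_convergence)
      show "integrable lborel (\<lambda>\<theta>. indicator {0..2 * pi} \<theta> *\<^sub>R (np_bound k * exp (4 * k\<^sup>2)))"
        by (rule borel_integrable_atLeastAtMost'[unfolded set_integrable_def]) (intro continuous_intros)
      show "AE \<theta> in lborel. (\<lambda>i. indicator {0..<2 * pi} \<theta> *\<^sub>R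
          (indicator {\<theta>. S i < dist (cis t) (cis \<theta>)} \<theta> *\<^sub>R h \<theta>))
        \<longlonglongrightarrow> indicator {0..2 * pi} \<theta> *\<^sub>R h \<theta>"
        \<comment> \<open>The exceptional points are \<open>t\<close>, which every truncation
          removes, and \<open>2 * pi\<close>, which separates the half-open parameter interval from
          the closed one.\<close>
        using AE_lborel_singleton[of t] AE_lborel_singleton[of "2 * pi"]
      proof eventually_elim
        case (elim \<theta>)
        show ?case
        proof (cases "\<theta> \<in> {0..<2 * pi}")
          case True
          then have "dist (cis t) (cis \<theta>) > 0"
            using assms elim cis_neq[of t \<theta>] by auto
          with S(2) have "eventually (\<lambda>i. S i < dist (cis t) (cis \<theta>)) sequentially"
            by (rule order_tendstoD)
          then have "eventually (\<lambda>i. indicator {0..<2 * pi} \<theta> *\<^sub>R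
            (indicator {\<theta>. S i < dist (cis t) (cis \<theta>)} \<theta> *\<^sub>R h \<theta>) = indicator {0..2 * pi} \<theta> *\<^sub>R h \<theta>) sequentially"
            by eventually_elim (use True in simp)
          then show ?thesis by (rule tendsto_eventually)
        next
          case False
          then have "indicator {0..<2 * pi} \<theta> = (0::real)" "indicator {0..2 * pi} \<theta> = (0::real)"
            using elim by auto
          then show ?thesis by simp
        qed
      qed
      show "AE \<theta> in lborel. norm (indicator {0..<2 * pi} \<theta> *\<^sub>R
          (indicator {\<theta>. S i < dist (cis t) (cis \<theta>)} \<theta> *\<^sub>R h \<theta>))
        \<le> indicator {0..2 * pi} \<theta> *\<^sub>R (np_bound k * exp (4 * k\<^sup>2))" for i
      proof (rule AE_I2)
        fix \<theta>
        have "0 \<le> np_bound k * exp (4 * k\<^sup>2)" using np_bound_nonneg[of k] by simp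
        with hb[of \<theta>] show "norm (indicator {0..<2 * pi} \<theta> *\<^sub>R
            (indicator {\<theta>. S i < dist (cis t) (cis \<theta>)} \<theta> *\<^sub>R h \<theta>))
          \<le> indicator {0..2 * pi} \<theta> *\<^sub>R (np_bound k * exp (4 * k\<^sup>2))"
          by (cases "S i < dist (cis t) (cis \<theta>)"; cases "\<theta> \<in> {0..<2 * pi}")
             (simp_all add: indicator_def)
      qed
    qed measurable
    then show "(\<lambda>i. X (S i)) \<longlonglongrightarrow> (LINT \<theta>|lborel. indicator {0..2 * pi} \<theta> *\<^sub>R h \<theta>)"
      unfolding X_def h_def using truncated_neumann_poincare_eq[OF assms(1) S(1)] by simp
  qed simp
  then have "neumann_poincare k (circle_exp n) (cis t) = (LINT \<theta>|lborel. indicator {0..2 * pi} \<theta> *\<^sub>R h \<theta>)"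
    unfolding neumann_poincare_def X_def by (intro tendsto_Lim) auto
  also have "\<dots> = integral {0..2 * pi} h"
    using set_borel_integral_eq_integral(2)[OF borel_integrable_atLeastAtMost'[OF cont], of 0 "2 * pi"]
    by (simp add: set_lebesgue_integral_def)
  also have "\<dots> = (\<Sum>m. np_fourier k n m) * circle_exp n (cis t)"
    unfolding h_def circle_exp_cis_eq_cis using assms sums_unique[OF np_fourier_sums, of k n]
    by (subst integral_np_kernel_shift) auto
  finally show ?thesis .
qed

text \<open>Existence uses that each point of the circle is \<open>cis\<close> of an angle in one
  period; uniqueness follows by evaluating at 1, where the eigenfunction is 1.\<close>

lemma np_eigenvalue_eq:
  assumes "k > 0"
  shows "np_eigenvalue n k = (\<Sum>m. np_fourier k n m)"
  unfolding np_eigenvalue_def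
proof (rule the_equality)
  show *: "\<forall>x\<in>sphere 0 1. neumann_poincare k (circle_exp n) x = (\<Sum>m. np_fourier k n m) * circle_exp n x"
  proof
    fix x :: complex assume "x \<in> sphere 0 1"
    then have "x = cis (Arg2pi x)"
      using Arg2pi_eq[of x] by (simp add: cis_conv_exp)
    then show "neumann_poincare k (circle_exp n) x = (\<Sum>m. np_fourier k n m) * circle_exp n x"
      using neumann_poincare_circle_exp[OF assms, of "Arg2pi x" n] Arg2pi[of x] by simp
  qed
  fix \<kappa>
  assume "\<forall>x\<in>sphere 0 1. neumann_poincare k (circle_exp n) x = \<kappa> * circle_exp n x"
  then have "neumann_poincare k (circle_exp n) 1 = \<kappa> * circle_exp n 1"
    by simp
  moreover have "neumann_poincare k (circle_exp n) 1 = (\<Sum>m. np_fourier k n m) * circle_exp n 1"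
    using * by simp
  moreover have "circle_exp n 1 = 1"
    by (simp add: circle_exp_eq)
  ultimately show "\<kappa> = (\<Sum>m. np_fourier k n m)"
    by simp
qed

lemma summable_np_fourier: "summable (np_fourier k n)"
  using np_fourier_sums by (rule sums_summable)

subsection \<open>Limit and asymptotics\<close>

lemma np_eigenvalue_tendsto:
  "((\<lambda>k. np_eigenvalue n k) \<longlongrightarrow> (if n = 0 then 1 / 2 else 0)) (at_right 0)"
proof -
  have "norm (np_eigenvalue n k - np_fourier k n 0) \<le> 2 * pi * np_bound k * (exp (4 * k\<^sup>2) - 1)"
    if "k > 0" for k
  proof -
    have "(\<lambda>m. (4 * k\<^sup>2) ^ m / fact m) sums exp (4 * k\<^sup>2)"
      using exp_converges[of "4 * k\<^sup>2"] by (simp add: field_simps)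
    then have "(\<lambda>m. (4 * k\<^sup>2) ^ Suc m / fact (Suc m)) sums (exp (4 * k\<^sup>2) - 1)"
      by (subst sums_Suc_iff) simp
    then have s: "(\<lambda>m. 2 * pi * np_bound k * ((4 * k\<^sup>2) ^ Suc m / fact (Suc m))) sums
        (2 * pi * np_bound k * (exp (4 * k\<^sup>2) - 1))"
      by (rule sums_mult)
    have "np_eigenvalue n k - np_fourier k n 0 = (\<Sum>m. np_fourier k n (Suc m))"
      using suminf_split_head[OF summable_np_fourier] np_eigenvalue_eq[OF that] by simp
    also have "norm \<dots> \<le> (\<Sum>m. 2 * pi * np_bound k * ((4 * k\<^sup>2) ^ Suc m / fact (Suc m)))"
      by (intro norm_suminf_le norm_np_fourier_le sums_summable[OF s])
    finally show ?thesis by (simp only: sums_unique[OF s])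
  qed
  then have "eventually (\<lambda>k. norm (np_eigenvalue n k - (if n = 0 then 1 / 2 else 0))
      \<le> 2 * pi * np_bound k * (exp (4 * k\<^sup>2) - 1)) (at_right 0)"
    unfolding np_fourier_0 using eventually_at_right_less[of 0] by (rule eventually_mono[rotated])
  \<comment> \<open>\<open>np_bound k\<close> grows only like
    \<open>\<bar>ln (k\<^sup>2)\<bar>\<close>, while the exponential difference is of order
    \<open>k\<^sup>2\<close>.\<close>
  moreover have "((\<lambda>k. 2 * pi * np_bound k * (exp (4 * k\<^sup>2) - 1)) \<longlongrightarrow> 0) (at_right 0)"
    unfolding np_bound_def by real_asymp
  ultimately show ?thesis
    by (rule LIM_zero_cancel[OF Lim_null_comparison])
qed

section \<open>Factorial estimates and decay of the higher terms\<close>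

lemma power_mult_fact_le: "n ^ Suc m * fact (n - 1) \<le> (fact (n + m) :: nat)" if "n > 0"
proof (induction m)
  case 0
  then show ?case using that by (simp add: fact_reduce)
next
  case (Suc m)
  have "n * (n ^ Suc m * fact (n - 1)) \<le> Suc (n + m) * fact (n + m)"
    using Suc by (intro mult_mono) auto
  then show ?case by (simp add: mult_ac)
qed

text \<open>For \<open>m \<ge> 3\<close>, \<open>fact (n + m) / fact (n - 1)\<close> has
  \<open>m + 1 \<ge> 4\<close> factors, each at least \<open>n\<close>. For \<open>m = 2\<close>
  that leaves only \<open>n ^ 3\<close>, so the five factors of
  \<open>fact (n + 2) / fact (n - 3)\<close> are compared with \<open>2 * n ^ 4\<close> directly;
  the constant 3 makes this hold coefficientwise in \<open>j = n - 3\<close>.\<close>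

lemma fact_diff_mult_power4_le:
  assumes "2 \<le> m" "m < n"
  shows "fact (n - m - 1) * fact m * n ^ 4 \<le> 3 * (fact (n + m) :: nat)"
proof (cases "m = 2")
  case True
  obtain j where n: "n = 3 + j" using assms True less_iff_Suc_add[of 2 n] by auto
  have "2 * (3 + j) ^ 4 \<le> 3 * ((j + 5) * (j + 4) * (j + 3) * (j + 2) * (j + 1))"
    by (simp add: power4_eq_xxxx algebra_simps)
  then have "fact j * (2 * (3 + j) ^ 4) \<le> fact j * (3 * ((j + 5) * (j + 4) * (j + 3) * (j + 2) * (j + 1)))"
    by (rule mult_left_mono) simp
  also have "\<dots> = 3 * fact (j + 5)"
  proof -
    have "fact (j + 1) = (j + 1) * fact j" "fact (j + 2) = (j + 2) * fact (j + 1)"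
      "fact (j + 3) = (j + 3) * fact (j + 2)" "fact (j + 4) = (j + 4) * fact (j + 3)"
      "fact (j + 5) = (j + 5) * fact (j + 4)"
      by (simp_all add: fact_reduce)
    then show ?thesis by (simp only: mult_ac)
  qed
  finally have "fact j * (2 * (3 + j) ^ 4) \<le> (3 * fact (j + 5) :: nat)" .
  moreover have "n - m - 1 = j" "n + m = j + 5" "fact m = (2 :: nat)" "n = 3 + j"
    using n True by simp_all
  ultimately show ?thesis by (simp only: mult.assoc)
next
  case False
  have "n ^ 4 \<le> n ^ Suc m"
    using assms False by (intro power_increasing) auto
  moreover have "fact (n - m - 1) * fact m \<le> (fact (n - m - 1 + m) :: nat)"
    by (rule dvd_imp_le[OF fact_fact_dvd_fact]) simp
  moreover have "n - m - 1 + m = n - 1" using assms by simp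
  ultimately have "fact (n - m - 1) * fact m * n ^ 4 \<le> fact (n - 1) * n ^ Suc m"
    by (metis mult_le_mono)
  also have "\<dots> \<le> fact (n + m)"
    using power_mult_fact_le[of n m] assms by (simp add: mult_ac)
  finally show ?thesis by simp
qed

lemma fact_double_le: "(fact (2 * m) :: real) \<le> 4 ^ m * (fact m)\<^sup>2"
proof -
  have "fact m * fact m * (2 * m choose m) = (fact (2 * m) :: nat)"
    using binomial_fact_lemma[of m "2 * m"] by simp
  moreover have "2 * m choose m \<le> 4 ^ m"
    using binomial_le_pow2[of "2 * m" m] by (simp add: power_mult)
  ultimately have "(fact (2 * m) :: nat) \<le> fact m * fact m * 4 ^ m"
    by (metis mult_le_mono2)
  then have "real (fact (2 * m)) \<le> real (fact m * fact m * 4 ^ m)"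
    by (simp only: of_nat_le_iff)
  then show ?thesis by (simp add: power2_eq_square mult_ac)
qed

text \<open>A summable majorant common to two regimes. For \<open>m < n\<close> the explicit moment
  gives the constant \<open>3 / 2\<close>. For \<open>m \<ge> n\<close> the uniform bound suffices,
  because \<open>n ^ 4 \<le> m ^ 4 \<le> 16 ^ m\<close>; hence \<open>64 = 4 * 16\<close>.\<close>

lemma norm_np_fourier_le_power4:
  assumes "2 \<le> m" "2 \<le> n"
  shows "norm (np_fourier k n m) \<le> (2 * pi * np_bound k + 3 / 2) * ((64 * k\<^sup>2) ^ m / fact m) / real n ^ 4"
proof (cases "m < n")
  case True
  have "norm (np_fourier k n m) = real m * (k\<^sup>2) ^ m / 2 *
      (fact (2 * m) / (4 ^ m * (fact m)\<^sup>2)) * (fact (n - m - 1) / fact (n + m))"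
    unfolding np_fourier_eq_log_moment[OF True] norm_of_real
    by (simp add: abs_mult abs_divide power_abs abs_bessel_coeff log_moment_def mult_ac)
  also have "\<dots> \<le> 2 ^ m * (k\<^sup>2) ^ m / 2 * 1 * (3 / (fact m * real n ^ 4))"
  proof (intro mult_mono divide_right_mono real_le_two_power)
    show "fact (2 * m) / (4 ^ m * (fact m)\<^sup>2) \<le> (1::real)"
      using fact_double_le[of m] by (simp add: divide_simps)
    have "real (fact (n - m - 1) * fact m * n ^ 4) \<le> real (3 * fact (n + m))"
      using fact_diff_mult_power4_le[OF assms(1) True] by (simp only: of_nat_le_iff)
    then show "fact (n - m - 1) / fact (n + m) \<le> 3 / (fact m * real n ^ 4)"
      using assms by (simp add: divide_simps mult_ac)
  qed auto
  also have "\<dots> = 3 / 2 * ((2 * k\<^sup>2) ^ m / fact m) / real n ^ 4"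
    by (simp add: power_mult_distrib)
  also have "\<dots> \<le> (2 * pi * np_bound k + 3 / 2) * ((64 * k\<^sup>2) ^ m / fact m) / real n ^ 4"
  proof -
    have "(2 * k\<^sup>2) ^ m \<le> (64 * k\<^sup>2) ^ m" by (rule power_mono) auto
    then show ?thesis
      using np_bound_nonneg[of k] by (intro divide_right_mono mult_mono) auto
  qed
  finally show ?thesis .
next
  case False
  have "real n ^ 4 \<le> real m ^ 4"
    using False by (intro power_mono) auto
  also have "\<dots> \<le> (2 ^ m) ^ 4"
    by (intro power_mono real_le_two_power) auto
  also have "\<dots> = 16 ^ m"
    by (simp add: power_mult [symmetric] mult.commute[of m])  (simp add: power_mult)
  finally have n: "real n ^ 4 \<le> 16 ^ m" .
  have "norm (np_fourier k n m) * real n ^ 4 \<le> (2 * pi * np_bound k * ((4 * k\<^sup>2) ^ m / fact m)) * 16 ^ m"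
    using np_bound_nonneg[of k] by (intro mult_mono norm_np_fourier_le n) auto
  also have "\<dots> = 2 * pi * np_bound k * ((64 * k\<^sup>2) ^ m / fact m)"
  proof -
    have "(64::real) ^ m = 4 ^ m * 16 ^ m" by (simp flip: power_mult_distrib)
    then show ?thesis by (simp add: power_mult_distrib)
  qed
  also have "\<dots> \<le> (2 * pi * np_bound k + 3 / 2) * ((64 * k\<^sup>2) ^ m / fact m)"
    by (intro mult_right_mono) auto
  finally show ?thesis using assms by (subst pos_le_divide_eq) auto
qed

lemma np_fourier_1:
  assumes "2 \<le> n"
  shows "np_fourier k n 1 = of_real (- (k\<^sup>2 / (4 * real n * (real n - 1) * (real n + 1))))"
proof -
  obtain j where n: "n = Suc (Suc j)"
    using assms by (metis add_2_eq_Suc le_Suc_ex)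
  have f: "n - 1 - 1 = j" "n + 1 = Suc (Suc (Suc j))" using n by auto
  have "bessel_coeff 1 * (k\<^sup>2) ^ 1 / (4 * pi) * real 1 * log_moment 1 n
      = - (k\<^sup>2 / (4 * real n * (real n - 1) * (real n + 1)))"
    unfolding log_moment_def f fact_Suc bessel_coeff_def
    by (simp add: n divide_simps)
  then show ?thesis
    using np_fourier_eq_log_moment[of 1 n k] assms by simp
qed

text \<open>For \<open>n \<ge> 2\<close> the term \<open>m = 0\<close> vanishes and
  \<open>m = 1\<close> is the leading term, so the error is the tail from \<open>m = 2\<close>. Its
  constant \<open>C * E / k ^ 4\<close> depends on \<open>k\<close>, which is fixed.\<close>

lemma np_eigenvalue_asymptotics:
  assumes "k > 0"
  shows "(\<lambda>n. np_eigenvalue n k - of_real (- (k\<^sup>2 / (4 * real n * (real n - 1) * (real n + 1)))))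
    \<in> O[at_top](\<lambda>n. of_real (k ^ 4 / real n ^ 4))"
proof -
  define C where "C = 2 * pi * np_bound k + 3 / 2"
  define E where "E = (\<Sum>m. (64 * k\<^sup>2) ^ (m + 2) / fact (m + 2))"
  have s: "(\<lambda>m. C * ((64 * k\<^sup>2) ^ (m + 2) / fact (m + 2)) / real n ^ 4) sums (C * E / real n ^ 4)" for n
    unfolding E_def
    by (intro sums_divide sums_mult summable_sums summable_ignore_initial_segment summable_power_div_fact)
  have "norm (np_eigenvalue n k - of_real (- (k\<^sup>2 / (4 * real n * (real n - 1) * (real n + 1)))))
      \<le> C * E / k ^ 4 * norm (of_real (k ^ 4 / real n ^ 4) :: complex)" if n: "2 \<le> n" for n
  proof -
    have "(\<Sum>m. np_fourier k n m) = (\<Sum>m. np_fourier k n (m + 2)) + (\<Sum>m<2. np_fourier k n m)"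
      by (rule suminf_split_initial_segment[OF summable_np_fourier])
    then have "np_eigenvalue n k - np_fourier k n 1 = (\<Sum>m. np_fourier k n (m + 2))"
      using n by (simp add: np_eigenvalue_eq[OF assms] numeral_2_eq_2 np_fourier_0)
    also have "norm \<dots> \<le> (\<Sum>m. C * ((64 * k\<^sup>2) ^ (m + 2) / fact (m + 2)) / real n ^ 4)"
      unfolding C_def
      by (intro norm_suminf_le norm_np_fourier_le_power4 sums_summable[OF s[unfolded C_def]] n) simp
    also have "\<dots> = C * E / real n ^ 4"
      by (rule sums_unique[OF s, symmetric])
    also have "\<dots> = C * E / k ^ 4 * norm (of_real (k ^ 4 / real n ^ 4) :: complex)"
      unfolding norm_of_real using assms by (simp add: abs_divide power_abs)
    finally show ?thesis unfolding np_fourier_1[OF n] .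
  qed
  then show ?thesis
    by (intro bigoI[where c = "C * E / k ^ 4"] eventually_mono[OF eventually_ge_at_top[of 2]])
qed

theorem theorem4p1:
  shows "(\<forall>n::nat. ((\<lambda>k::real. np_eigenvalue n k) \<longlongrightarrow> (if n = 0 then 1 / 2 else 0)) (at_right 0)) \<and>
    (\<forall>k::real. k > 0 \<longrightarrow>
      (\<lambda>n::nat. np_eigenvalue n k
          - of_real (- (k\<^sup>2 / (4 * real n * (real n - 1) * (real n + 1)))))
        \<in> O[at_top](\<lambda>n::nat. of_real (k ^ 4 / real n ^ 4)))"
  using np_eigenvalue_tendsto np_eigenvalue_asymptotics by blast

end
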